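(* If $G \neq K_2$ is a simple connected subcubic graph, then $\operatorname{lir}(^2G)\leq 3$.
   Context: All graphs are finite and without loops. A graph is subcubic if its maximum degree is at most three. A multigraph $M$ consists of a nonempty finite vertex set and a multiset of edges (2-element subsets of the vertex set); the degree of a vertex is the sum of the multiplicities of the edges incident to it. For a simple graph $G$, $^2G$ denotes the 2-multigraph obtained from $G$ by replacing each edge of $G$ with two parallel edges. A multigraph is locally irregular if every two adjacent vertices have different degrees. An edge coloring of a multigraph $M$ assigns a color to each element of the edge multiset (it need not be proper, and parallel edges may receive different colors); it is locally irregular if, for each color, the submultigraph of $M$ induced by the edges of that color is locally irregular. The locally irregular chromatic index $\operatorname{lir}(M)$ is the smallest number of colors in a locally irregular edge coloring of $M$, if one exists; so $\operatorname{lir}(M)\leq k$ means that $M$ has a locally irregular edge coloring using at most $k$ colors. *)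

theory Defs
  imports "HOL-Library.Multiset" "HOL-Library.Extended_Nat"
begin

section \<open>Simple graphs\<close>

record 'a graph =
  verts :: "'a set"
  edges :: "'a set set"

definition simple_graph :: "'a graph \<Rightarrow> bool" where
  "simple_graph G \<longleftrightarrow> finite (verts G) \<and> verts G \<noteq> {} \<and>
     (\<forall>e\<in>edges G. e \<subseteq> verts G \<and> card e = 2)"

definition connected_graph :: "'a graph \<Rightarrow> bool" where
  "connected_graph G \<longleftrightarrow>
     (\<forall>u\<in>verts G. \<forall>v\<in>verts G. (u, v) \<in> {(x, y). {x, y} \<in> edges G}\<^sup>*)"

definition degree :: "'a graph \<Rightarrow> 'a \<Rightarrow> nat" where
  "degree G v = card {e \<in> edges G. v \<in> e}"

definition max_degree :: "'a graph \<Rightarrow> nat" where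
  "max_degree G = Max (degree G ` verts G)"

definition subcubic :: "'a graph \<Rightarrow> bool" where
  "subcubic G \<longleftrightarrow> max_degree G \<le> 3"

definition complete_graph :: "nat \<Rightarrow> nat graph" where
  "complete_graph n = \<lparr>verts = {..<n}, edges = {e. e \<subseteq> {..<n} \<and> card e = 2}\<rparr>"

definition graph_isomorphic :: "'a graph \<Rightarrow> 'b graph \<Rightarrow> bool" where
  "graph_isomorphic G H \<longleftrightarrow>
     (\<exists>f. bij_betw f (verts G) (verts H) \<and>
        (\<forall>u\<in>verts G. \<forall>v\<in>verts G. {u, v} \<in> edges G \<longleftrightarrow> {f u, f v} \<in> edges H))"


section \<open>Multigraphs\<close>

record 'a multigraph =
  mverts :: "'a set"
  medges :: "'a set multiset"

definition multigraph :: "'a multigraph \<Rightarrow> bool" where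
  "multigraph M \<longleftrightarrow> finite (mverts M) \<and> mverts M \<noteq> {} \<and>
     (\<forall>e \<in># medges M. e \<subseteq> mverts M \<and> card e = 2)"

definition mdegree :: "'a multigraph \<Rightarrow> 'a \<Rightarrow> nat" where
  "mdegree M v = (\<Sum>e\<in>{e \<in> set_mset (medges M). v \<in> e}. count (medges M) e)"

definition two_multigraph :: "'a graph \<Rightarrow> 'a multigraph" where
  "two_multigraph G = \<lparr>mverts = verts G, medges = repeat_mset 2 (mset_set (edges G))\<rparr>"

definition locally_irregular :: "'a multigraph \<Rightarrow> bool" where
  "locally_irregular M \<longleftrightarrow>
     (\<forall>u\<in>mverts M. \<forall>v\<in>mverts M. {u, v} \<in># medges M \<longrightarrow> mdegree M u \<noteq> mdegree M v)"

text \<open>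
  The elements of the edge multiset are made distinguishable by numbering parallel edges:
  the pair of \<^term>\<open>e\<close> and \<^term>\<open>i\<close> stands for the \<^term>\<open>i\<close>-th of the parallel copies of
  \<^term>\<open>e\<close>. An edge coloring is a function on these pairs; its values elsewhere are irrelevant.
\<close>

definition edge_copies :: "'a multigraph \<Rightarrow> ('a set \<times> nat) set" where
  "edge_copies M = (SIGMA e:set_mset (medges M). {..<count (medges M) e})"

definition color_class :: "'a multigraph \<Rightarrow> ('a set \<times> nat \<Rightarrow> nat) \<Rightarrow> nat \<Rightarrow> 'a multigraph" where
  "color_class M c k =
     \<lparr>mverts = \<Union> (fst ` {x \<in> edge_copies M. c x = k}),
      medges = image_mset fst (mset_set {x \<in> edge_copies M. c x = k})\<rparr>"

definition colors_used :: "'a multigraph \<Rightarrow> ('a set \<times> nat \<Rightarrow> nat) \<Rightarrow> nat set" where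
  "colors_used M c = c ` edge_copies M"

definition locally_irregular_coloring :: "'a multigraph \<Rightarrow> ('a set \<times> nat \<Rightarrow> nat) \<Rightarrow> bool" where
  "locally_irregular_coloring M c \<longleftrightarrow>
     (\<forall>k\<in>colors_used M c. locally_irregular (color_class M c k))"

text \<open>The index is \<^term>\<open>\<infinity>\<close> if there is no locally irregular edge coloring.\<close>

definition lir :: "'a multigraph \<Rightarrow> enat" where
  "lir M = (INF c\<in>{c. locally_irregular_coloring M c}. enat (card (colors_used M c)))"


section \<open>Basic facts\<close>

lemma multigraph_two_multigraph:
  assumes "simple_graph G"
  shows "multigraph (two_multigraph G)"
proof -
  have "edges G \<subseteq> Pow (verts G)" "finite (verts G)"
    using assms by (auto simp: simple_graph_def)
  then have "finite (edges G)"
    by (meson finite_Pow_iff finite_subset)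
  then have "set_mset (repeat_mset 2 (mset_set (edges G))) = edges G"
    by (intro set_eqI) (simp flip: count_greater_zero_iff add: count_mset_set')
  then show ?thesis
    using assms by (auto simp: simple_graph_def multigraph_def two_multigraph_def)
qed

lemma finite_edge_copies: "finite (edge_copies M)"
  by (simp add: edge_copies_def)

lemma image_fst_edge_copies: "image_mset fst (mset_set (edge_copies M)) = medges M"
proof (rule multiset_eqI)
  fix e
  have "{x \<in> edge_copies M. e = fst x} = Pair e ` {..<count (medges M) e}"
    by (auto simp: edge_copies_def intro: count_inI)
  then have "card {x \<in> edge_copies M. e = fst x} = count (medges M) e"
    by (simp add: card_image inj_on_def)
  then show "count (image_mset fst (mset_set (edge_copies M))) e = count (medges M) e"
    by (simp add: count_image_mset' finite_edge_copies)
qed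

lemma lir_le_iff:
  "lir M \<le> enat k \<longleftrightarrow> (\<exists>c. locally_irregular_coloring M c \<and> card (colors_used M c) \<le> k)"
proof
  assume le: "lir M \<le> enat k"
  let ?S = "(\<lambda>c. enat (card (colors_used M c))) ` {c. locally_irregular_coloring M c}"
  have "?S \<noteq> {}"
  proof
    assume "?S = {}"
    then have "lir M = \<infinity>"
      by (simp add: lir_def Inf_enat_def)
    with le show False by simp
  qed
  then have "Inf ?S \<in> ?S"
    by (metis (no_types, lifting) LeastI Inf_enat_def ex_in_conv)
  then show "\<exists>c. locally_irregular_coloring M c \<and> card (colors_used M c) \<le> k"
    using le by (auto simp: lir_def)
next
  assume "\<exists>c. locally_irregular_coloring M c \<and> card (colors_used M c) \<le> k"
  then show "lir M \<le> enat k"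
    unfolding lir_def by (auto intro: INF_lower2)
qed

end

(* Take a cut with the maximum number of crossing edges. As the graph is subcubic and connected, the
   inside edges form a matching and the crossing edges connect all vertices. If one side B has even size,
   two colours suffice: by parity there is a set J of edges that meets exactly the vertices of B oddly
   often; each edge of J gives one copy to each colour, every other edge gives both copies to one colour.
   Adjacent vertices on different sides then differ in parity, and the remaining freedom in colouring the
   edges outside J separates the ends of the inside edges. If both sides are odd, the third colour takes a
   star whose removal leaves the crossing edges connected and makes one side even; when the vertex to be
   removed is a leaf it may instead be moved to the other side. *)

theory Submission
  imports Defs
begin

section \<open>Separating the members of two matchings at once\<close>

section \<open>Matchings\<close>

lemma pair_containing: "card e = 2 \<Longrightarrow> x \<in> e \<Longrightarrow> \<exists>y. y \<noteq> x \<and> e = {x, y}"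
  by (auto simp: card_2_iff)

lemma card_Int_pair: "a \<noteq> b \<Longrightarrow> card ({a, b} \<inter> S) = 1 \<longleftrightarrow> (a \<in> S) \<noteq> (b \<in> S)"
  by (auto simp: Int_insert_left)

lemma card_Int_cong: "(\<And>x. x \<in> p \<Longrightarrow> x \<in> S \<longleftrightarrow> x \<in> T) \<Longrightarrow> card (p \<inter> S) = card (p \<inter> T)"
  by (rule arg_cong[where f = card]) blast

text \<open>The components of a union of two matchings are paths and even cycles, so it is
  bipartite, and \<open>S\<close> is one colour class. The induction on \<open>P\<close> keeps
  \<open>Q\<close> arbitrary because \<open>Q\<close> is altered around the removed edge
  \<open>p\<close>.\<close>

lemma two_matchings_bicolourable:
  fixes P Q :: "'b set set"
  assumes "finite P"
    and "\<And>p. p \<in> P \<union> Q \<Longrightarrow> card p = 2"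
    and "pairwise disjnt P" "pairwise disjnt Q"
  shows "\<exists>S. \<forall>p\<in>P \<union> Q. card (p \<inter> S) = 1"
  using assms
proof (induction P arbitrary: Q rule: finite_induct)
  case empty
  let ?S = "(\<lambda>p. SOME x. x \<in> p) ` Q"
  have "p \<inter> ?S = {SOME x. x \<in> p}" if p: "p \<in> Q" for p
  proof -
    have mem: "(SOME x. x \<in> q) \<in> q" if "q \<in> Q" for q
    proof -
      have "q \<noteq> {}" using that empty(1)[of q] by auto
      then show ?thesis by (simp add: some_in_eq)
    qed
    have "(SOME x. x \<in> q) \<notin> p" if "q \<in> Q" "q \<noteq> p" for q
      using mem[OF that(1)] pairwiseD[OF empty(3) that(1) p that(2)] by (auto simp: disjnt_iff)
    then show ?thesis using mem[OF p] p by auto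
  qed
  then show ?case by (intro exI[of _ ?S]) auto
next
  case (insert p P)
  obtain a b where p: "p = {a, b}" "a \<noteq> b"
    using insert.prems(1)[of p] by (auto simp: card_2_iff)
  have aP: "a \<notin> q" "b \<notin> q" if "q \<in> P" for q
    using insert.prems(2) insert.hyps(2) that p
    by (auto simp: pairwise_insert disjnt_iff)
  have pwP: "pairwise disjnt P" using insert.prems(2) by (auto simp: pairwise_insert)
  \<comment> \<open>It is enough to solve the problem for \<open>P\<close> and a suitable matching
    \<open>Q'\<close>, and then to repair \<open>p\<close> and \<open>Q\<close> by changing
    \<open>S\<close> only at \<open>a\<close> and \<open>b\<close>, which no member of
    \<open>P\<close> contains.\<close>
  have step: ?case
    if Q': "\<And>q. q \<in> Q' \<Longrightarrow> card q = 2" "pairwise disjnt Q'"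
      and extend: "\<And>S. \<forall>q\<in>P \<union> Q'. card (q \<inter> S) = 1 \<Longrightarrow>
        \<exists>S'. (\<forall>x. x \<noteq> a \<longrightarrow> x \<noteq> b \<longrightarrow> x \<in> S' \<longleftrightarrow> x \<in> S) \<and> (\<forall>q\<in>insert p Q. card (q \<inter> S') = 1)"
    for Q'
  proof -
    obtain S where S: "\<forall>q\<in>P \<union> Q'. card (q \<inter> S) = 1"
      using insert.IH[of Q'] Q' pwP insert.prems(1) by auto
    then obtain S' where S': "\<forall>x. x \<noteq> a \<longrightarrow> x \<noteq> b \<longrightarrow> x \<in> S' \<longleftrightarrow> x \<in> S"
      "\<forall>q\<in>insert p Q. card (q \<inter> S') = 1"
      using extend[OF S] by blast
    have "card (q \<inter> S') = 1" if "q \<in> P" for q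
      using card_Int_cong[of q S' S] S'(1) aP[OF that] S that by (metis UnCI)
    with S' show ?thesis by blast
  qed
  have cong: "card (q \<inter> S') = 1"
    if "card (q \<inter> S) = 1" "a \<notin> q" "b \<notin> q" "\<forall>x. x \<noteq> a \<longrightarrow> x \<noteq> b \<longrightarrow> x \<in> S' \<longleftrightarrow> x \<in> S" for q S S'
    using that card_Int_cong[of q S' S] by metis
  have Qd: "q = q'" if "q \<in> Q" "q' \<in> Q" "x \<in> q" "x \<in> q'" for q q' x
    using insert.prems(3) that unfolding pairwise_def disjnt_iff by blast
  have free: ?case if c: "c \<in> p" and cQ: "\<And>q. q \<in> Q \<Longrightarrow> c \<notin> q" for c
  proof -
    obtain d where d: "p = {c, d}" "c \<noteq> d" using p c by blast
    show ?thesis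
    proof (rule step[of Q])
      fix S
      assume S: "\<forall>q\<in>P \<union> Q. card (q \<inter> S) = 1"
      let ?S = "if d \<in> S then S - {c} else insert c S"
      have "card (q \<inter> ?S) = 1" if "q \<in> Q" for q
      proof -
        have "card (q \<inter> ?S) = card (q \<inter> S)"
          using cQ[OF that] by (intro card_Int_cong) auto
        with S that show ?thesis by simp
      qed
      moreover have "card (p \<inter> ?S) = 1"
        using d by (simp only: card_Int_pair) auto
      moreover have "\<forall>x. x \<noteq> a \<longrightarrow> x \<noteq> b \<longrightarrow> x \<in> ?S \<longleftrightarrow> x \<in> S" using c p by auto
      ultimately show "\<exists>S'. (\<forall>x. x \<noteq> a \<longrightarrow> x \<noteq> b \<longrightarrow> x \<in> S' \<longleftrightarrow> x \<in> S) \<and> (\<forall>q\<in>insert p Q. card (q \<inter> S') = 1)"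
        by (intro exI[of _ ?S]) blast
    qed (use insert.prems in auto)
  qed
  consider "\<exists>c\<in>p. \<forall>q\<in>Q. c \<notin> q" | q q' where "q \<in> Q" "a \<in> q" "q' \<in> Q" "b \<in> q'"
    using p by blast
  then show ?case
  proof cases
    case 1
    then show ?thesis using free by blast
  next
    case 2
    obtain a' where a': "q = {a, a'}" "a' \<noteq> a"
      using pair_containing[of q a] insert.prems(1)[of q] 2 by blast
    obtain b' where b': "q' = {b, b'}" "b' \<noteq> b"
      using pair_containing[of q' b] insert.prems(1)[of q'] 2 by blast
    show ?thesis
    proof (cases "q = q'")
      case True
      then have qp: "q = p" using a' b' p by auto
      show ?thesis
      \<comment> \<open>As a member of both matchings, \<open>p\<close> meets no other member, so
        its ends can be separated freely.\<close>
      proof (rule step[of "Q - {p}"])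
        fix S
        assume S: "\<forall>q\<in>P \<union> (Q - {p}). card (q \<inter> S) = 1"
        let ?S = "insert a S - {b}"
        have "card (r \<inter> ?S) = 1" if "r \<in> Q - {p}" for r
        proof (rule cong[of r S])
          show "a \<notin> r" "b \<notin> r" using Qd[of p r] that 2 qp p by auto
        qed (use S that in auto)
        moreover have "card (p \<inter> ?S) = 1"
          using p by (simp only: card_Int_pair) auto
        ultimately show "\<exists>S'. (\<forall>x. x \<noteq> a \<longrightarrow> x \<noteq> b \<longrightarrow> x \<in> S' \<longleftrightarrow> x \<in> S) \<and> (\<forall>q\<in>insert p Q. card (q \<inter> S') = 1)"
          by (intro exI[of _ ?S]) auto
      qed (use insert.prems in \<open>auto simp: pairwise_def\<close>)
    next
      case False
      have ne: "a' \<noteq> b'" "a' \<noteq> b" "b' \<noteq> a"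
        using Qd[of q q'] 2 a' b' False by auto
      txt \<open>Contract the path \<open>a' a b b'\<close>, whose middle edge is \<open>p\<close>, to the single edge \<open>a' b'\<close>.\<close>
      show ?thesis
      proof (rule step[of "insert {a', b'} (Q - {q, q'})"])
        fix S
        assume S: "\<forall>r\<in>P \<union> insert {a', b'} (Q - {q, q'}). card (r \<inter> S) = 1"
        \<comment> \<open>The ends of the contracted edge are separated by \<open>S\<close>. Placing
          \<open>a\<close> opposite to \<open>a'\<close> and \<open>b\<close> opposite to
          \<open>b'\<close> therefore also separates \<open>a\<close> from \<open>b\<close>.\<close>
        let ?S = "S - {a, b} \<union> {x. x = a \<and> a' \<notin> S \<or> x = b \<and> b' \<notin> S}"
        have "(a' \<in> S) \<noteq> (b' \<in> S)" using S ne(1) card_Int_pair[of a' b' S] by blast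
        then have "card (p \<inter> ?S) = 1"
          unfolding p(1) card_Int_pair[OF p(2)] using p(2) by auto
        moreover have "card (q \<inter> ?S) = 1"
          unfolding a'(1) card_Int_pair[OF a'(2)[symmetric]] using ne a' p(2) by auto
        moreover have "card (q' \<inter> ?S) = 1"
          unfolding b'(1) card_Int_pair[OF b'(2)[symmetric]] using ne b' p(2) by auto
        moreover have "card (r \<inter> ?S) = 1" if "r \<in> Q - {q, q'}" for r
        proof (rule cong[of r S])
          show "a \<notin> r" "b \<notin> r" using Qd[of q r] Qd[of q' r] that 2 by auto
        qed (use S that in auto)
        ultimately show "\<exists>S'. (\<forall>x. x \<noteq> a \<longrightarrow> x \<noteq> b \<longrightarrow> x \<in> S' \<longleftrightarrow> x \<in> S) \<and> (\<forall>r\<in>insert p Q. card (r \<inter> S') = 1)"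
          by (intro exI[of _ ?S]) auto
      next
        show "pairwise disjnt (insert {a', b'} (Q - {q, q'}))"
          unfolding pairwise_insert
        proof (intro conjI allI impI)
          fix r
          assume "r \<in> Q - {q, q'} \<and> r \<noteq> {a', b'}"
          then show "disjnt {a', b'} r" "disjnt r {a', b'}"
            using Qd[of q r a'] Qd[of q' r b'] 2 a' b' by auto
        next
          show "pairwise disjnt (Q - {q, q'})"
            using insert.prems(3) by (rule pairwise_subset) blast
        qed
      next
        show "card r = 2" if "r \<in> insert {a', b'} (Q - {q, q'})" for r
          using that ne(1) insert.prems(1)[of r] by auto
      qed
    qed
  qed
qed

section \<open>Degrees, crossing edges and T-joins\<close>

section \<open>Edge sets with prescribed parities\<close>

definition edeg :: "'a set set \<Rightarrow> 'a \<Rightarrow> nat" where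
  "edeg E v = card {e \<in> E. v \<in> e}"

definition crosses :: "'a set \<Rightarrow> 'a set \<Rightarrow> bool" where
  "crosses B e \<longleftrightarrow> card (e \<inter> B) = 1"

text \<open>The degree of \<open>v\<close> in the multigraph that has \<open>w e\<close> parallel
  copies of each edge \<open>e\<close> of \<open>E\<close>.\<close>

definition wdeg :: "'a set set \<Rightarrow> ('a set \<Rightarrow> nat) \<Rightarrow> 'a \<Rightarrow> nat" where
  "wdeg E w v = (\<Sum>e\<in>{e \<in> E. v \<in> e}. w e)"

text \<open>Both ends of a step must lie in \<open>W\<close>, so vertices are deleted by shrinking
  \<open>W\<close> while \<open>F\<close> stays fixed. Points outside \<open>W\<close> reach only
  themselves.\<close>

definition reach :: "'a set set \<Rightarrow> 'a set \<Rightarrow> ('a \<times> 'a) set" where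
  "reach F W = {(x, y). {x, y} \<in> F \<and> x \<in> W \<and> y \<in> W}\<^sup>*"

definition connected_via :: "'a set set \<Rightarrow> 'a set \<Rightarrow> bool" where
  "connected_via F W \<longleftrightarrow> (\<forall>x\<in>W. \<forall>y\<in>W. (x, y) \<in> reach F W)"

lemma crosses_pair: "x \<noteq> y \<Longrightarrow> crosses B {x, y} \<longleftrightarrow> (x \<in> B) \<noteq> (y \<in> B)"
  unfolding crosses_def by (rule card_Int_pair)

lemma odd_edeg_sym_diff:
  assumes "finite J" "finite K"
  shows "odd (edeg (sym_diff J K) v) \<longleftrightarrow> odd (edeg J v) \<noteq> odd (edeg K v)"
proof -
  let ?f = "\<lambda>E. {e \<in> E. v \<in> e}"
  have "?f (sym_diff J K) = sym_diff (?f J) (?f K)" by auto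
  moreover have "card (?f J) = card (?f J \<inter> ?f K) + card (?f J - ?f K)"
    using assms by (intro card_Int_Diff) auto
  moreover have "card (?f K) = card (?f K \<inter> ?f J) + card (?f K - ?f J)"
    using assms by (intro card_Int_Diff) auto
  moreover have "?f K \<inter> ?f J = ?f J \<inter> ?f K" by blast
  moreover have "card (sym_diff (?f J) (?f K)) = card (?f J - ?f K) + card (?f K - ?f J)"
    using assms by (intro card_Un_disjoint) auto
  ultimately show ?thesis unfolding edeg_def by simp presburger
qed

text \<open>Each edge of the walk, added by symmetric difference, flips the parity at its two ends,
  so the flips at inner vertices cancel. For \<open>x = y\<close> all degrees come out even.\<close>

lemma path_join:
  assumes "(x, y) \<in> reach F W" "finite F" "\<And>e. e \<in> F \<Longrightarrow> card e = 2"
  shows "\<exists>J\<subseteq>F. \<forall>v. odd (edeg J v) \<longleftrightarrow> (v = x) \<noteq> (v = y)"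
  using assms(1) unfolding reach_def
proof (induction rule: rtrancl_induct)
  case base
  show ?case by (rule exI[of _ "{}"]) (simp add: edeg_def)
next
  case (step y z)
  then obtain J where J: "J \<subseteq> F" "\<And>v. odd (edeg J v) \<longleftrightarrow> (v = x) \<noteq> (v = y)" by blast
  have yz: "{y, z} \<in> F" using step by auto
  then have "y \<noteq> z" using assms(3) by fastforce
  then have *: "odd (edeg {{y, z}} v) \<longleftrightarrow> (v = y) \<noteq> (v = z)" for v
  proof -
    have "{e \<in> {{y, z}}. v \<in> e} = (if v = y \<or> v = z then {{y, z}} else {})" by auto
    with \<open>y \<noteq> z\<close> show ?thesis by (auto simp: edeg_def)
  qed
  have "finite J" using finite_subset[OF J(1) assms(2)] .
  then have "odd (edeg (sym_diff J {{y, z}}) v) \<longleftrightarrow> (v = x) \<noteq> (v = z)" for v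
    using J(2) * by (subst odd_edeg_sym_diff) auto
  with J yz show ?case by (intro exI[of _ "sym_diff J {{y, z}}"]) auto
qed

text \<open>\<open>J\<close> is a \<open>T\<close>-join. The elements of \<open>T\<close> are paired
  off arbitrarily, and the edge sets that \<open>path_join\<close> gives for the pairs are combined
  by symmetric difference.\<close>

lemma join_exists:
  assumes "finite F" "\<And>e. e \<in> F \<Longrightarrow> card e = 2" "connected_via F W" "finite T" "T \<subseteq> W" "even (card T)"
  shows "\<exists>J\<subseteq>F. \<forall>v. odd (edeg J v) \<longleftrightarrow> v \<in> T"
  using assms(4-6)
proof (induction "card T" arbitrary: T rule: less_induct)
  case less
  show ?case
  proof (cases "T = {}")
    case True
    then show ?thesis by (intro exI[of _ "{}"]) (simp add: edeg_def)
  next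
    case False
    then obtain x where x: "x \<in> T" by blast
    have "T \<noteq> {x}" using less by auto
    then obtain y where y: "y \<in> T" "y \<noteq> x" using x by blast
    let ?T = "T - {x, y}"
    have c: "card T = card ?T + 2"
      using x y less(2) card_Int_Diff[of T "{x, y}"] by (simp add: Int_absorb1)
    then obtain J where J: "J \<subseteq> F" "\<And>v. odd (edeg J v) \<longleftrightarrow> v \<in> ?T"
      using less(1)[of ?T] less(2-4) by auto
    have "(x, y) \<in> reach F W" using x y less(3) assms(3) unfolding connected_via_def by blast
    from path_join[OF this assms(1,2)]
    obtain K where K: "K \<subseteq> F" "\<And>v. odd (edeg K v) \<longleftrightarrow> (v = x) \<noteq> (v = y)" by blast
    have "finite J" "finite K"
      using finite_subset[OF J(1) assms(1)] finite_subset[OF K(1) assms(1)] by auto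
    then have "odd (edeg (sym_diff J K) v) \<longleftrightarrow> v \<in> T" for v
      using J(2)[of v] K(2)[of v] x y by (subst odd_edeg_sym_diff) auto
    with J K show ?thesis by (intro exI[of _ "sym_diff J K"]) auto
  qed
qed

section \<open>Splitting the edge copies between two colours\<close>

section \<open>Two colours\<close>

lemma wdeg_two_minus:
  assumes "finite E" "\<And>e. e \<in> E \<Longrightarrow> w e \<le> 2"
  shows "wdeg E w v + wdeg E (\<lambda>e. 2 - w e) v = 2 * edeg E v"
proof -
  have "wdeg E w v + wdeg E (\<lambda>e. 2 - w e) v = (\<Sum>e\<in>{e \<in> E. v \<in> e}. 2)"
    unfolding wdeg_def sum.distrib[symmetric] by (rule sum.cong) (use assms in auto)
  then show ?thesis by (simp add: edeg_def)
qed

lemma odd_wdeg: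
  assumes "finite E" "J \<subseteq> E" "\<And>e. e \<in> E \<Longrightarrow> odd (w e) \<longleftrightarrow> e \<in> J"
  shows "odd (wdeg E w v) \<longleftrightarrow> odd (edeg J v)"
proof -
  have "{e \<in> {e \<in> E. v \<in> e}. odd (w e)} = {e \<in> J. v \<in> e}" using assms by auto
  then show ?thesis using assms(1) by (simp add: wdeg_def edeg_def even_sum_iff)
qed

text \<open>
  Of the two copies of \<open>e\<close>, the first colour takes \<open>w e\<close> and the second takes \<open>2 - w e\<close>.
\<close>

definition two_weighting :: "'a set set \<Rightarrow> ('a set \<Rightarrow> nat) \<Rightarrow> bool" where
  "two_weighting E w \<longleftrightarrow> (\<forall>e. w e \<le> 2) \<and> (\<forall>u v. {u, v} \<in> E \<longrightarrow>
    (w {u, v} > 0 \<longrightarrow> wdeg E w u \<noteq> wdeg E w v) \<and>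
    (w {u, v} < 2 \<longrightarrow> wdeg E (\<lambda>e. 2 - w e) u \<noteq> wdeg E (\<lambda>e. 2 - w e) v))"

text \<open>
  The edges of \<open>J\<close> are split evenly between the two colours. Then both degrees of \<open>v\<close> are odd
  exactly for \<open>v \<in> B\<close>, which settles the crossing edges. The parity condition on \<open>J\<close> at an inside
  edge with ends of equal degree is chosen so that each end lies on exactly one crossing edge outside
  \<open>J\<close>; the edge is settled once these two crossing edges get different colours.
\<close>

lemma two_weighting_of_parity:
  fixes E :: "'a set set"
  assumes fin: "finite E" and two: "\<And>e. e \<in> E \<Longrightarrow> card e = 2"
    and deg: "\<And>v. edeg E v \<le> 3"
    and matching: "\<And>e e'. \<lbrakk>e \<in> E; e' \<in> E; \<not> crosses B e; \<not> crosses B e'; e \<inter> e' \<noteq> {}\<rbrakk> \<Longrightarrow> e = e'"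
    and JE: "J \<subseteq> E" and par: "\<And>v. odd (edeg J v) \<longleftrightarrow> v \<in> B"
    and J_uneq: "\<And>u v. \<lbrakk>{u, v} \<in> E; \<not> crosses B {u, v}; edeg E u \<noteq> edeg E v\<rbrakk> \<Longrightarrow> {u, v} \<notin> J"
    and J_eq: "\<And>u v. \<lbrakk>{u, v} \<in> E; \<not> crosses B {u, v}; edeg E u = edeg E v\<rbrakk> \<Longrightarrow>
      edeg E u \<ge> 2 \<and> ({u, v} \<in> J \<longleftrightarrow> (edeg E u = 3) \<noteq> (u \<in> B))"
  shows "\<exists>w. two_weighting E w"
proof -
  have finJ: "finite J" using finite_subset[OF JE fin] .
  have ne: "u \<noteq> v" if "{u, v} \<in> E" for u v using two[OF that] by auto
  have inside: "u \<in> B \<longleftrightarrow> v \<in> B" if "{u, v} \<in> E" "\<not> crosses B {u, v}" for u v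
    using that crosses_pair[OF ne[OF that(1)], of B] by simp
  \<comment> \<open>Crossing edges at \<open>x\<close>, split by the parity of their future weight:
    0 or 2 in \<open>ev\<close>, 1 in \<open>od\<close>.\<close>
  define ev where "ev x = {g \<in> E. x \<in> g \<and> crosses B g \<and> g \<notin> J}" for x
  define od where "od x = {g \<in> E. x \<in> g \<and> crosses B g \<and> g \<in> J}" for x
  have fin_ev: "finite (ev x)" "finite (od x)" for x using fin by (auto simp: ev_def od_def)
  have star: "{g \<in> E. u \<in> g \<and> \<not> crosses B g} = {{u, v}}" if "{u, v} \<in> E" "\<not> crosses B {u, v}" for u v
  proof -
    have "g = {u, v}" if "g \<in> E" "u \<in> g" "\<not> crosses B g" for g
      using matching[OF that(1) \<open>{u, v} \<in> E\<close> that(3) \<open>\<not> crosses B {u, v}\<close>] that(2) by blast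
    with that show ?thesis by blast
  qed
  \<comment> \<open>Since \<open>u\<close> has a single inside edge, it lies on one or two crossing
    edges, according to whether its degree is 2 or 3. By \<open>par\<close> and \<open>J_eq\<close>,
    the number of those in \<open>J\<close> is even for degree 2 and odd for degree 3, that is, 0 or
    1.\<close>
  have counts: "card (ev u) = 1 \<and> card (od u) = edeg E u - 2"
    if e: "{u, v} \<in> E" "\<not> crosses B {u, v}" "edeg E u = edeg E v" for u v
  proof -
    have "{g \<in> E. u \<in> g} = insert {u, v} (ev u \<union> od u)"
      using star[OF e(1,2)] by (auto simp: ev_def od_def)
    moreover have "{u, v} \<notin> ev u \<union> od u" using e by (auto simp: ev_def od_def)
    moreover have "ev u \<inter> od u = {}" by (auto simp: ev_def od_def)
    ultimately have "edeg E u = Suc (card (ev u) + card (od u))"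
      using fin_ev by (simp add: edeg_def card_Un_disjoint)
    moreover have "{g \<in> J. u \<in> g} = od u \<union> ({g \<in> E. u \<in> g \<and> \<not> crosses B g} \<inter> J)"
      using JE by (auto simp: od_def)
    then have "{g \<in> J. u \<in> g} = od u \<union> ({{u, v}} \<inter> J)"
      unfolding star[OF e(1,2)] .
    then have "edeg J u = (if {u, v} \<in> J then Suc (card (od u)) else card (od u))"
      using fin_ev e by (simp add: edeg_def od_def)
    moreover note par[of u] J_eq[OF e] deg[of u]
    ultimately show ?thesis by (cases "{u, v} \<in> J"; cases "u \<in> B"; simp; presburger)
  qed
  define f where "f x = the_elem (ev x)" for x
  have f: "ev u = {f u}" if "{u, v} \<in> E" "\<not> crosses B {u, v}" "edeg E u = edeg E v" for u v
    using counts[OF that] by (auto simp: f_def card_1_singleton_iff)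
  define M where "M = {e \<in> E. \<not> crosses B e \<and> (\<forall>u\<in>e. \<forall>v\<in>e. edeg E u = edeg E v)}"
  txt \<open>A crossing edge has one end on either side, so the pairs that have to be separated form two
    matchings on the set of crossing edges: one from the inside edges in \<open>B\<close>, one from the others.\<close>
  define P where "P = {f ` e |e. e \<in> M \<and> e \<subseteq> B}"
  define Q where "Q = {f ` e |e. e \<in> M \<and> e \<inter> B = {}}"
  have fM: "f x \<in> E" "x \<in> f x" "crosses B (f x)" "f x \<notin> J" "ev x = {f x}" if e: "e \<in> M" "x \<in> e" for e x
  proof -
    obtain y where y: "e = {x, y}"
      using pair_containing[of e x] e two[of e] by (auto simp: M_def)
    have "{x, y} \<in> E" "\<not> crosses B {x, y}" "edeg E x = edeg E y"
      using e(1) unfolding y M_def by blast+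
    then have "ev x = {f x}" by (rule f)
    then show "f x \<in> E" "x \<in> f x" "crosses B (f x)" "f x \<notin> J" "ev x = {f x}" by (auto simp: ev_def)
  qed
  have f_inj: "x = y" if "e \<in> M" "x \<in> e" "e' \<in> M" "y \<in> e'" "x \<in> B \<longleftrightarrow> y \<in> B" "f x = f y" for e e' x y
  proof (rule ccontr)
    assume "x \<noteq> y"
    moreover have "x \<in> f x" "y \<in> f x" using fM(2)[OF that(1,2)] fM(2)[OF that(3,4)] that(6) by auto
    moreover have "card (f x) = 2" using two fM(1)[OF that(1,2)] by blast
    ultimately have "f x = {x, y}" by (auto simp: card_2_iff)
    then show False using fM(3)[OF that(1,2)] crosses_pair[OF \<open>x \<noteq> y\<close>, of B] that(5) by simp
  qed
  have card_f: "card (f ` e) = 2" if "e \<in> M" "e \<subseteq> B \<or> e \<inter> B = {}" for e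
  proof -
    have "inj_on f e" using f_inj[OF that(1) _ that(1)] that(2) by (intro inj_onI) blast
    then show ?thesis using that two by (simp add: card_image M_def)
  qed
  have disj_f: "disjnt (f ` e) (f ` e')"
    if "e \<in> M" "e' \<in> M" "f ` e \<noteq> f ` e'" "e \<subseteq> B \<and> e' \<subseteq> B \<or> e \<inter> B = {} \<and> e' \<inter> B = {}" for e e'
  proof -
    have "e \<in> E" "e' \<in> E" "\<not> crosses B e" "\<not> crosses B e'" using that(1,2) by (auto simp: M_def)
    then have "e \<inter> e' = {}" using matching that(3) by blast
    moreover have "f x \<noteq> f y" if "x \<in> e" "y \<in> e'" "x \<noteq> y" for x y
      using f_inj[OF \<open>e \<in> M\<close> that(1) \<open>e' \<in> M\<close> that(2)] that
        \<open>e \<subseteq> B \<and> e' \<subseteq> B \<or> e \<inter> B = {} \<and> e' \<inter> B = {}\<close> by blast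
    ultimately show ?thesis unfolding disjnt_iff by blast
  qed
  have "\<exists>S. \<forall>p\<in>P \<union> Q. card (p \<inter> S) = 1"
  proof (rule two_matchings_bicolourable)
    have "P \<subseteq> (\<lambda>e. f ` e) ` E" by (auto simp: P_def M_def)
    then show "finite P" using fin finite_subset by (metis finite_imageI)
    show "card p = 2" if "p \<in> P \<union> Q" for p using that card_f by (auto simp: P_def Q_def)
    show "pairwise disjnt P" "pairwise disjnt Q"
      by (rule pairwiseI; unfold P_def Q_def; elim CollectE exE conjE; hypsubst; rule disj_f; blast)+
  qed
  then obtain S where S: "\<forall>p\<in>P \<union> Q. card (p \<inter> S) = 1" by blast
  have S_M: "(f u \<in> S) \<noteq> (f v \<in> S)"
    if e: "{u, v} \<in> E" "\<not> crosses B {u, v}" "edeg E u = edeg E v" for u v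
  proof -
    have M: "{u, v} \<in> M" using e by (auto simp: M_def)
    have "{u, v} \<subseteq> B \<or> {u, v} \<inter> B = {}" using inside[OF e(1,2)] by auto
    then have "f ` {u, v} \<in> P \<union> Q" using M unfolding P_def Q_def by blast
    then have "{f u, f v} \<in> P \<union> Q" by simp
    moreover have "f u \<noteq> f v"
      using f_inj[OF M _ M, of u v] inside[OF e(1,2)] ne[OF e(1)] by auto
    ultimately show ?thesis using S card_Int_pair[of "f u" "f v" S] by blast
  qed
  define w0 where "w0 g = (if g \<in> J then 1 else if g \<in> S then 2 else 0 :: nat)" for g
  define h where "h v = (\<Sum>g\<in>{g \<in> E. v \<in> g \<and> crosses B g}. w0 g)" for v
  \<comment> \<open>An inside edge outside \<open>J\<close> gives both copies to the first colour if
    its ends differ in \<open>h\<close>, the contribution of the crossing edges. Otherwise both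
    copies go to the second colour, where the degrees are twice \<open>edeg\<close> minus
    \<open>h\<close>; these differ because equal \<open>h\<close> occurs only for unequal
    \<open>edeg\<close>.\<close>
  define w where "w g = (if crosses B g \<or> g \<in> J then w0 g else if \<exists>u\<in>g. \<exists>v\<in>g. h u \<noteq> h v then 2 else 0)" for g
  have w2: "w e \<le> 2" for e by (auto simp: w_def w0_def)
  have w_odd: "odd (w e) \<longleftrightarrow> e \<in> J" for e by (auto simp: w_def w0_def)
  have sum2: "wdeg E w v + wdeg E (\<lambda>e. 2 - w e) v = 2 * edeg E v" for v
    by (rule wdeg_two_minus[OF fin w2])
  \<comment> \<open>The crossing edges in \<open>J\<close> contribute \<open>edeg - 2\<close> at
    both ends, so the values of \<open>h\<close> differ by the 2 that \<open>S\<close> gives to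
    exactly one of \<open>f u\<close> and \<open>f v\<close>.\<close>
  have h_eq: "h u \<noteq> h v" if e: "{u, v} \<in> E" "\<not> crosses B {u, v}" "edeg E u = edeg E v" for u v
  proof -
    have h1: "h x = edeg E x - 2 + (if f x \<in> S then 2 else 0)"
      if e: "{x, y} \<in> E" "\<not> crosses B {x, y}" "edeg E x = edeg E y" for x y
    proof -
      have "{g \<in> E. x \<in> g \<and> crosses B g} = od x \<union> ev x" by (auto simp: od_def ev_def)
      moreover have "od x \<inter> ev x = {}" by (auto simp: od_def ev_def)
      ultimately have "h x = (\<Sum>g\<in>od x. w0 g) + (\<Sum>g\<in>ev x. w0 g)"
        unfolding h_def using fin_ev by (simp add: sum.union_disjoint)
      moreover have "(\<Sum>g\<in>od x. w0 g) = card (od x)"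
        by (simp add: od_def w0_def)
      moreover have "f x \<notin> J" using f[OF e] by (auto simp: ev_def)
      then have "(\<Sum>g\<in>ev x. w0 g) = (if f x \<in> S then 2 else 0)"
        unfolding f[OF e] by (simp add: w0_def)
      ultimately show ?thesis using counts[OF e] by simp
    qed
    have "{v, u} \<in> E" "\<not> crosses B {v, u}" using e by (simp_all add: insert_commute)
    then show ?thesis using h1[OF e] h1[of v u] S_M[OF e] e(3) by auto
  qed
  have wd: "wdeg E w u = h u + w {u, v}" if e: "{u, v} \<in> E" "\<not> crosses B {u, v}" for u v
  proof -
    have *: "{g \<in> E. u \<in> g} = {g \<in> E. u \<in> g \<and> crosses B g} \<union> {g \<in> E. u \<in> g \<and> \<not> crosses B g}" by blast
    have "wdeg E w u = (\<Sum>g\<in>{g \<in> E. u \<in> g \<and> crosses B g}. w g) + (\<Sum>g\<in>{g \<in> E. u \<in> g \<and> \<not> crosses B g}. w g)"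
      unfolding wdeg_def * using fin by (intro sum.union_disjoint) auto
    moreover have "(\<Sum>g\<in>{g \<in> E. u \<in> g \<and> crosses B g}. w g) = h u"
      unfolding h_def by (rule sum.cong) (auto simp: w_def)
    ultimately show ?thesis by (simp add: star[OF e])
  qed
  have "(w {u, v} > 0 \<longrightarrow> wdeg E w u \<noteq> wdeg E w v) \<and>
    (w {u, v} < 2 \<longrightarrow> wdeg E (\<lambda>e. 2 - w e) u \<noteq> wdeg E (\<lambda>e. 2 - w e) v)" if e: "{u, v} \<in> E" for u v
  proof (cases "crosses B {u, v}")
    case True
    then have "(u \<in> B) \<noteq> (v \<in> B)" using crosses_pair[OF ne[OF e]] by blast
    moreover have "odd (wdeg E w x) \<longleftrightarrow> x \<in> B" for x
      using odd_wdeg[OF fin JE] w_odd par by blast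
    ultimately have "odd (wdeg E w u) \<noteq> odd (wdeg E w v)" by blast
    moreover have "odd (wdeg E (\<lambda>e. 2 - w e) x) \<longleftrightarrow> odd (wdeg E w x)" for x
      using sum2[of x] by (metis even_add dvd_triv_left)
    ultimately show ?thesis by metis
  next
    case False
    have wu: "wdeg E w u = h u + w {u, v}" using wd[OF e False] .
    have wv: "wdeg E w v = h v + w {u, v}" using wd[of v u] e False by (simp add: insert_commute)
    show ?thesis
    proof (cases "h u = h v")
      case True
      then have "edeg E u \<noteq> edeg E v" using h_eq[OF e False] by blast
      moreover from this have "w {u, v} = 0" using True J_uneq[OF e False] False by (auto simp: w_def)
      ultimately show ?thesis using sum2[of u] sum2[of v] wu wv True by auto
    next
      case neq: False
      show ?thesis
      proof (cases "edeg E u = edeg E v")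
        case True
        then show ?thesis using sum2[of u] sum2[of v] wu wv neq by auto
      next
        case False
        then have "w {u, v} = 2" using neq J_uneq[OF e \<open>\<not> crosses B {u, v}\<close>] \<open>\<not> crosses B {u, v}\<close> by (auto simp: w_def)
        then show ?thesis using wu wv neq by auto
      qed
    qed
  qed
  then show ?thesis using w2 unfolding two_weighting_def by blast
qed

section \<open>Building the parity set from an even side\<close>

lemma edeg_mono: "finite E \<Longrightarrow> E' \<subseteq> E \<Longrightarrow> edeg E' v \<le> edeg E v"
  unfolding edeg_def by (rule card_mono) auto

lemma card_le_edeg:
  assumes "finite E" "\<And>y. y \<in> N \<Longrightarrow> {u, y} \<in> E"
  shows "card N \<le> edeg E u"
proof -
  have "inj_on (\<lambda>y. {u, y}) N" by (auto simp: inj_on_def doubleton_eq_iff)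
  then have "card N = card ((\<lambda>y. {u, y}) ` N)" by (simp add: card_image)
  also have "\<dots> \<le> edeg E u" unfolding edeg_def using assms by (intro card_mono) auto
  finally show ?thesis .
qed

text \<open>\<open>K\<close> consists of the inside edges that
  \<open>two_weighting_of_parity\<close> forces into \<open>J\<close>. Crossing edges then correct
  the parities by a join for the symmetric difference of \<open>B\<close> and
  \<open>\<Union> K\<close>, which has even size because \<open>K\<close> is a matching and
  \<open>B\<close> is even. The crossing edges need to connect only \<open>W\<close>; this leaves
  room for vertices at which nothing is to be corrected, such as a leaf moved across the
  cut.\<close>

lemma two_weighting_exists:
  fixes E :: "'a set set"
  assumes fin: "finite E" and two: "\<And>e. e \<in> E \<Longrightarrow> card e = 2"
    and deg: "\<And>v. edeg E v \<le> 3"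
    and matching: "\<And>e e'. \<lbrakk>e \<in> E; e' \<in> E; \<not> crosses B e; \<not> crosses B e'; e \<inter> e' \<noteq> {}\<rbrakk> \<Longrightarrow> e = e'"
    and W: "finite W" "B \<subseteq> W" "even (card B)" "connected_via {e \<in> E. crosses B e} W"
    and eqW: "\<And>u v. \<lbrakk>{u, v} \<in> E; \<not> crosses B {u, v}; edeg E u = edeg E v\<rbrakk> \<Longrightarrow> u \<in> W \<and> v \<in> W"
  shows "\<exists>w. two_weighting E w"
proof -
  let ?F = "{e \<in> E. crosses B e}"
  define K where "K = {e \<in> E. \<not> crosses B e \<and> (\<exists>u v. e = {u, v} \<and> edeg E u = edeg E v \<and> (edeg E u = 3) \<noteq> (u \<in> B))}"
  have K_iff: "{u, v} \<in> K \<longleftrightarrow> edeg E u = edeg E v \<and> (edeg E u = 3) \<noteq> (u \<in> B)"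
    if e: "{u, v} \<in> E" "\<not> crosses B {u, v}" for u v
  proof -
    have "u \<noteq> v" using two[OF e(1)] by auto
    then have "u \<in> B \<longleftrightarrow> v \<in> B" using e(2) crosses_pair by metis
    then show ?thesis using e by (auto simp: K_def doubleton_eq_iff)
  qed
  have finK: "finite K" using fin by (simp add: K_def)
  have odd_K: "odd (edeg K v) \<longleftrightarrow> v \<in> \<Union> K" for v
  proof (cases "v \<in> \<Union> K")
    case True
    then obtain e where e: "e \<in> K" "v \<in> e" by blast
    have "e' = e" if "e' \<in> K" "v \<in> e'" for e'
      using matching[of e' e] that e by (auto simp: K_def)
    then have "{e' \<in> K. v \<in> e'} = {e}" using e by blast
    then show ?thesis using True by (simp add: edeg_def)
  next
    case False
    then have "{e' \<in> K. v \<in> e'} = {}" by blast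
    then have "edeg K v = 0" unfolding edeg_def by (simp only: card.empty)
    then show ?thesis using False by simp
  qed
  have KW: "\<Union> K \<subseteq> W"
  proof
    fix x assume "x \<in> \<Union> K"
    then obtain u v where "{u, v} \<in> E" "\<not> crosses B {u, v}" "edeg E u = edeg E v" "x \<in> {u, v}"
      by (auto simp: K_def)
    then show "x \<in> W" using eqW[of u v] by auto
  qed
  have "card (\<Union> K) = (\<Sum>e\<in>K. card e)"
  proof (rule card_Union_disjoint)
    show "pairwise disjnt K"
      by (rule pairwiseI) (use matching in \<open>auto simp: K_def disjnt_def\<close>)
    show "finite e" if "e \<in> K" for e
      using that two[of e] by (intro card_ge_0_finite) (auto simp: K_def)
  qed
  also have "\<dots> = (\<Sum>e\<in>K. 2)" by (rule sum.cong) (use two in \<open>auto simp: K_def\<close>)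
  finally have evenK: "even (card (\<Union> K))" by simp
  define T where "T = sym_diff B (\<Union> K)"
  have fins: "finite B" "finite (\<Union> K)"
    using finite_subset[OF W(2,1)] finite_subset[OF KW W(1)] by auto
  have "card B = card (B \<inter> \<Union> K) + card (B - \<Union> K)" using fins by (intro card_Int_Diff)
  moreover have "card (\<Union> K) = card (\<Union> K \<inter> B) + card (\<Union> K - B)" using fins by (intro card_Int_Diff)
  moreover have "card T = card (B - \<Union> K) + card (\<Union> K - B)"
    unfolding T_def using fins by (intro card_Un_disjoint) auto
  moreover have "\<Union> K \<inter> B = B \<inter> \<Union> K" by blast
  ultimately have "even (card T)" using W(3) evenK by simp
  moreover have "T \<subseteq> W" using W(2) KW by (auto simp: T_def)
  moreover have "finite T" using fins by (simp add: T_def)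
  ultimately obtain H where H: "H \<subseteq> ?F" "\<And>v. odd (edeg H v) \<longleftrightarrow> v \<in> T"
    using join_exists[of ?F W T] fin two W(4) by auto
  define J where "J = H \<union> K"
  have finH: "finite H" using finite_subset[OF H(1)] fin by simp
  have "J = sym_diff H K" using H(1) by (auto simp: J_def K_def)
  then have par: "odd (edeg J v) \<longleftrightarrow> v \<in> B" for v
    using odd_edeg_sym_diff[OF finH finK, of v] H(2)[of v] odd_K[of v] by (auto simp: T_def)
  have J_iff: "{u, v} \<in> J \<longleftrightarrow> {u, v} \<in> K" if "\<not> crosses B {u, v}" for u v
    using H(1) that by (auto simp: J_def)
  show ?thesis
  proof (rule two_weighting_of_parity[OF fin two deg, of B J])
    show "e = e'" if "e \<in> E" "e' \<in> E" "\<not> crosses B e" "\<not> crosses B e'" "e \<inter> e' \<noteq> {}" for e e'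
      using matching that by blast
    show "J \<subseteq> E" using H(1) by (auto simp: J_def K_def)
    show "odd (edeg J v) \<longleftrightarrow> v \<in> B" for v by (rule par)
    show "{u, v} \<notin> J" if "{u, v} \<in> E" "\<not> crosses B {u, v}" "edeg E u \<noteq> edeg E v" for u v
      using J_iff[OF that(2)] K_iff[OF that(1,2)] that(3) by simp
    show "edeg E u \<ge> 2 \<and> ({u, v} \<in> J \<longleftrightarrow> (edeg E u = 3) \<noteq> (u \<in> B))"
      if e: "{u, v} \<in> E" "\<not> crosses B {u, v}" "edeg E u = edeg E v" for u v
    proof
      have "u \<noteq> v" using two[OF e(1)] by auto
      \<comment> \<open>A path from \<open>u\<close> to \<open>v\<close> through crossing edges
        starts with a crossing edge at \<open>u\<close>. It differs from the inside edge
        \<open>{u, v}\<close>, so \<open>u\<close> has degree at least 2.\<close>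
      have "(u, v) \<in> reach ?F W" using eqW[OF e] W(4) by (simp add: connected_via_def)
      then obtain z where z: "{u, z} \<in> ?F"
        using \<open>u \<noteq> v\<close> unfolding reach_def by (cases rule: converse_rtranclE) auto
      have "card {z, v} \<le> edeg E u" by (rule card_le_edeg[OF fin]) (use z e in auto)
      moreover have "z \<noteq> v" using z e(2) by auto
      ultimately show "edeg E u \<ge> 2" by simp
      show "{u, v} \<in> J \<longleftrightarrow> (edeg E u = 3) \<noteq> (u \<in> B)"
        using J_iff[OF e(2)] K_iff[OF e(1,2)] e(3) by simp
    qed
  qed
qed

section \<open>Connected crossing edges and maximum cuts\<close>

section \<open>Connectivity and maximum cuts\<close>

lemma reach_refl: "(x, x) \<in> reach F W"
  by (simp add: reach_def)

lemma reach_step: "(x, y) \<in> reach F W \<Longrightarrow> {y, z} \<in> F \<Longrightarrow> y \<in> W \<Longrightarrow> z \<in> W \<Longrightarrow> (x, z) \<in> reach F W"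
  unfolding reach_def by (erule rtrancl_into_rtrancl) simp

lemma reach_sym: "(x, y) \<in> reach F W \<Longrightarrow> (y, x) \<in> reach F W"
proof -
  have "sym (reach F W)"
    unfolding reach_def by (rule sym_rtrancl) (auto simp: sym_def insert_commute)
  then show "(x, y) \<in> reach F W \<Longrightarrow> (y, x) \<in> reach F W" by (simp add: sym_def)
qed

lemma reach_trans: "(x, y) \<in> reach F W \<Longrightarrow> (y, z) \<in> reach F W \<Longrightarrow> (x, z) \<in> reach F W"
  unfolding reach_def by (rule rtrancl_trans)

lemma reach_mono:
  assumes "\<And>x y. x \<in> W \<Longrightarrow> y \<in> W \<Longrightarrow> {x, y} \<in> F \<Longrightarrow> {x, y} \<in> F'" "W \<subseteq> W'"
  shows "reach F W \<subseteq> reach F' W'"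
  unfolding reach_def by (rule rtrancl_mono) (use assms in auto)

lemma connected_via_mono:
  assumes "connected_via F W" "\<And>x y. x \<in> W \<Longrightarrow> y \<in> W \<Longrightarrow> {x, y} \<in> F \<Longrightarrow> {x, y} \<in> F'"
  shows "connected_via F' W"
  using assms(1) reach_mono[of W F F' W, OF assms(2)] unfolding connected_via_def by blast

lemma connected_via_insert:
  assumes "connected_via F S" "a \<in> S" "{a, b} \<in> F"
  shows "connected_via F (insert b S)"
proof -
  have "(a, x) \<in> reach F (insert b S)" if "x \<in> insert b S" for x
  proof (cases "x = b")
    case True
    show ?thesis unfolding True
      by (rule reach_step[OF reach_refl]) (use assms in auto)
  next
    case False
    then have "(a, x) \<in> reach F S" using assms that by (auto simp: connected_via_def)
    then show ?thesis using reach_mono[of S F F "insert b S"] by blast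
  qed
  then show ?thesis unfolding connected_via_def using reach_sym reach_trans by metis
qed

lemma reach_leaves:
  assumes "(x, y) \<in> reach F W" "x \<in> S" "y \<notin> S"
  obtains a b where "a \<in> S" "b \<in> W - S" "{a, b} \<in> F"
proof -
  have "y \<notin> S \<longrightarrow> (\<exists>a b. a \<in> S \<and> b \<in> W - S \<and> {a, b} \<in> F)"
    using assms(1) unfolding reach_def
    by (induction rule: rtrancl_induct) (use assms(2) in auto)
  then show ?thesis using assms(3) that by blast
qed

text \<open>A maximal connected nonempty proper subset of \<open>W\<close> misses exactly one
  vertex: some edge of \<open>F\<close> leaves it within \<open>W\<close>, and adding the outer end
  keeps it connected, so by maximality all of \<open>W\<close> is reached. As \<open>W\<close> has
  two elements, a singleton is such a subset to start from.\<close>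

lemma noncut_vertex:
  assumes "finite W" "connected_via F W" "x \<in> W" "y \<in> W" "x \<noteq> y"
  obtains r where "r \<in> W" "connected_via F (W - {r})"
proof -
  define \<S> where "\<S> = {S. S \<subset> W \<and> S \<noteq> {} \<and> connected_via F S}"
  have "finite \<S>" by (rule finite_subset[of _ "Pow W"]) (use assms(1) in \<open>auto simp: \<S>_def\<close>)
  moreover have "{x} \<in> \<S>" using assms by (auto simp: \<S>_def connected_via_def reach_refl)
  ultimately obtain S where S: "S \<in> \<S>" "\<And>S'. S' \<in> \<S> \<Longrightarrow> S \<subseteq> S' \<Longrightarrow> S' = S"
    using finite_has_maximal[of \<S>] by (metis empty_iff)
  obtain s t where "s \<in> S" "t \<in> W - S" using S(1) by (auto simp: \<S>_def)
  then have "(s, t) \<in> reach F W" using assms(2) S(1) by (auto simp: \<S>_def connected_via_def)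
  then obtain a b where ab: "a \<in> S" "b \<in> W - S" "{a, b} \<in> F"
    using reach_leaves \<open>s \<in> S\<close> \<open>t \<in> W - S\<close> by (metis DiffD2)
  have "connected_via F (insert b S)" using connected_via_insert[OF _ ab(1,3)] S(1) by (auto simp: \<S>_def)
  then have "insert b S = W" using S(2)[of "insert b S"] S(1) ab by (auto simp: \<S>_def)
  then have "W - {b} = S" using ab by auto
  then show ?thesis using that[of b] ab S(1) by (auto simp: \<S>_def)
qed

text \<open>\<open>u\<close> has at most one neighbour in \<open>W\<close>, so a walk through
  \<open>u\<close> enters and leaves by the same vertex, and the visit can be cut out.\<close>

lemma connected_via_remove_pendant:
  assumes "connected_via F W"
    and "\<And>x y. x \<in> W \<Longrightarrow> y \<in> W \<Longrightarrow> {u, x} \<in> F \<Longrightarrow> {u, y} \<in> F \<Longrightarrow> x = y"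
  shows "connected_via F (W - {u})"
proof -
  obtain z where z: "\<And>x. x \<in> W \<Longrightarrow> {u, x} \<in> F \<Longrightarrow> x = z"
    using assms(2) by metis
  have "if y = u then (x, z) \<in> reach F (W - {u}) else (x, y) \<in> reach F (W - {u})"
    if "(x, y) \<in> reach F W" "x \<noteq> u" for x y
    using that(1) unfolding reach_def[of _ W]
  proof (induction rule: rtrancl_induct)
    case base
    show ?case using that(2) by (simp add: reach_refl)
  next
    case (step y y')
    then have e: "{y, y'} \<in> F" "y \<in> W" "y' \<in> W" by auto
    consider "y = u" "y' = u" | "y = u" "y' \<noteq> u" | "y \<noteq> u" "y' = u" | "y \<noteq> u" "y' \<noteq> u" by blast
    then show ?case
    proof cases
      case 2
      then show ?thesis using step.IH z[of y'] e by auto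
    next
      case 3
      then show ?thesis using step.IH z[of y] e by (auto simp: insert_commute)
    next
      case 4
      then have "(x, y) \<in> reach F (W - {u})" using step.IH by simp
      from reach_step[OF this e(1)] 4 e show ?thesis by simp
    qed (use step.IH in auto)
  qed
  then show ?thesis using assms(1) unfolding connected_via_def by (metis DiffE singletonI)
qed

text \<open>\<open>B\<close> is a maximum cut. Switching a single vertex shows that it has at most
  as many inside as crossing edges, hence at most one inside edge as its degree is at most 3.
  Switching a component of the crossing edges shows that there is only one.\<close>

lemma connected_cut_exists:
  fixes E :: "'a set set"
  assumes "finite V" and E: "\<And>e. e \<in> E \<Longrightarrow> card e = 2 \<and> e \<subseteq> V"
    and deg: "\<And>v. edeg E v \<le> 3" and con: "connected_via E V"
  obtains B where "B \<subseteq> V" "connected_via {e \<in> E. crosses B e} V"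
    "\<And>e e'. \<lbrakk>e \<in> E; e' \<in> E; \<not> crosses B e; \<not> crosses B e'; e \<inter> e' \<noteq> {}\<rbrakk> \<Longrightarrow> e = e'"
proof -
  have "E \<subseteq> Pow V" using E by blast
  then have fin: "finite E" using assms(1) by (simp add: finite_subset)
  let ?n = "\<lambda>B. card {e \<in> E. crosses B e}"
  have "Max (?n ` Pow V) \<in> ?n ` Pow V" using assms(1) by (intro Max_in) auto
  then obtain B where B: "B \<subseteq> V" "Max (?n ` Pow V) = ?n B" by auto
  have max: "?n C \<le> ?n B" if "C \<subseteq> V" for C
    unfolding B(2)[symmetric] using assms(1) that by (intro Max_ge) auto
  \<comment> \<open>Moving \<open>S\<close> across the cut exchanges inside and crossing edges among
    the edges with one end in \<open>S\<close> and leaves the others as they are; maximality of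
    \<open>B\<close> forbids a gain.\<close>
  have switch: "card {e \<in> E. \<not> crosses B e \<and> crosses S e} \<le> card {e \<in> E. crosses B e \<and> crosses S e}"
    if "S \<subseteq> V" for S
  proof -
    have x: "crosses (sym_diff B S) e \<longleftrightarrow> crosses B e \<noteq> crosses S e" if "e \<in> E" for e
    proof -
      obtain p q where "e = {p, q}" "p \<noteq> q" using E[OF \<open>e \<in> E\<close>] by (auto simp: card_2_iff)
      then show ?thesis by (simp add: crosses_pair) blast
    qed
    have "{e \<in> E. crosses (sym_diff B S) e} = {e \<in> E. crosses B e \<and> \<not> crosses S e} \<union> {e \<in> E. \<not> crosses B e \<and> crosses S e}"
      using x by blast
    then have "?n (sym_diff B S) = card {e \<in> E. crosses B e \<and> \<not> crosses S e} + card {e \<in> E. \<not> crosses B e \<and> crosses S e}"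
      using fin by (simp only:) (rule card_Un_disjoint, auto)
    moreover have "{e \<in> E. crosses B e} = {e \<in> E. crosses B e \<and> \<not> crosses S e} \<union> {e \<in> E. crosses B e \<and> crosses S e}"
      by blast
    then have "?n B = card {e \<in> E. crosses B e \<and> \<not> crosses S e} + card {e \<in> E. crosses B e \<and> crosses S e}"
      using fin by (simp only:) (rule card_Un_disjoint, auto)
    moreover have "?n (sym_diff B S) \<le> ?n B" using max[of "sym_diff B S"] B(1) that by blast
    ultimately show ?thesis by linarith
  qed
  have "e = e'" if e: "e \<in> E" "e' \<in> E" "\<not> crosses B e" "\<not> crosses B e'" "e \<inter> e' \<noteq> {}" for e e'
  proof -
    obtain v where v: "v \<in> e" "v \<in> e'" using e by blast
    have cv: "crosses {v} g \<longleftrightarrow> v \<in> g" for g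
      by (cases "v \<in> g") (simp_all add: crosses_def)
    have "v \<in> V" using v e E by blast
    then have "card {g \<in> E. \<not> crosses B g \<and> v \<in> g} \<le> card {g \<in> E. crosses B g \<and> v \<in> g}"
      using switch[of "{v}"] by (simp add: cv)
    moreover have "{g \<in> E. v \<in> g} = {g \<in> E. \<not> crosses B g \<and> v \<in> g} \<union> {g \<in> E. crosses B g \<and> v \<in> g}" by blast
    then have "edeg E v = card {g \<in> E. \<not> crosses B g \<and> v \<in> g} + card {g \<in> E. crosses B g \<and> v \<in> g}"
      unfolding edeg_def using fin by (simp only:) (rule card_Un_disjoint, auto)
    ultimately have "card {g \<in> E. \<not> crosses B g \<and> v \<in> g} \<le> Suc 0" using deg[of v] by linarith
    then show ?thesis using fin v e by (subst (asm) card_le_Suc0_iff_eq) auto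
  qed
  moreover have "connected_via {e \<in> E. crosses B e} V"
    unfolding connected_via_def
  proof (intro ballI, rule ccontr)
    fix x y
    assume xy: "x \<in> V" "y \<in> V" "(x, y) \<notin> reach {e \<in> E. crosses B e} V"
    \<comment> \<open>The component of \<open>x\<close> under the crossing edges. No crossing edge
      leaves it, so by \<open>switch\<close> no edge of \<open>E\<close> leaves it, against
      connectedness.\<close>
    let ?S = "{y \<in> V. (x, y) \<in> reach {e \<in> E. crosses B e} V}"
    have closed: False if "{a, b} \<in> E" "crosses B {a, b}" "a \<in> ?S" "b \<notin> ?S" for a b
      using reach_step[of x a "{e \<in> E. crosses B e}" V b] that E by auto
    have "{e \<in> E. crosses B e \<and> crosses ?S e} = {}"
    proof (rule ccontr)
      assume "{e \<in> E. crosses B e \<and> crosses ?S e} \<noteq> {}"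
      then obtain e where e: "e \<in> E" "crosses B e" "crosses ?S e" by blast
      then obtain p q where "e = {p, q}" "p \<noteq> q" using E[OF e(1)] by (auto simp: card_2_iff)
      then show False
        using e closed[of p q] closed[of q p] crosses_pair[of p q ?S] by (auto simp: insert_commute)
    qed
    then have "card {e \<in> E. \<not> crosses B e \<and> crosses ?S e} = 0" using switch[of ?S] by (simp only:) auto
    then have no: "\<not> crosses ?S e" if "e \<in> E" for e
      using that fin \<open>{e \<in> E. crosses B e \<and> crosses ?S e} = {}\<close> by auto
    have "(x, y) \<in> reach E V" using con xy by (simp add: connected_via_def)
    moreover have "x \<in> ?S" "y \<notin> ?S" using xy by (auto simp: reach_refl)
    ultimately obtain a b where ab: "a \<in> ?S" "b \<in> V - ?S" "{a, b} \<in> E" by (rule reach_leaves)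
    then have "a \<noteq> b" by blast
    then have "crosses ?S {a, b}" using ab crosses_pair[of a b ?S] by blast
    then show False using no ab by blast
  qed
  ultimately show ?thesis using that B(1) by blast
qed

section \<open>From weights to colourings\<close>

section \<open>Three colours\<close>

text \<open>Degrees in a colour class depend only on how many copies of each edge the class
  contains, so a colouring may be given by these numbers \<open>wt k e\<close>. The copies of
  \<open>e\<close> are dealt out in order to the colours 0, 1 and 2.\<close>

lemma lir_two_multigraph_le_3:
  fixes G :: "'a graph" and wt :: "nat \<Rightarrow> 'a set \<Rightarrow> nat"
  assumes fin: "finite (edges G)"
    and total: "\<And>e. e \<in> edges G \<Longrightarrow> wt 0 e + wt 1 e + wt 2 e = 2"
    and irr: "\<And>k u v. \<lbrakk>k < 3; {u, v} \<in> edges G; wt k {u, v} > 0\<rbrakk> \<Longrightarrow>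
      wdeg (edges G) (wt k) u \<noteq> wdeg (edges G) (wt k) v"
  shows "lir (two_multigraph G) \<le> 3"
proof -
  let ?M = "two_multigraph G" and ?E = "edges G"
  define c :: "'a set \<times> nat \<Rightarrow> nat" where
    "c = (\<lambda>(e, i). if i < wt 0 e then 0 else if i < wt 0 e + wt 1 e then 1 else 2)"
  have cnt: "count (medges ?M) e = (if e \<in> ?E then 2 else 0)" for e
    using fin by (simp add: two_multigraph_def count_mset_set')
  then have "set_mset (medges ?M) = ?E"
    by (auto simp flip: count_greater_zero_iff split: if_splits)
  then have copies: "edge_copies ?M = ?E \<times> {..<2}"
    by (auto simp: edge_copies_def cnt)
  have class_count: "count (medges (color_class ?M c k)) e = (if e \<in> ?E then wt k e else 0)"
    if k: "k < 3" for k e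
  proof -
    have "count (medges (color_class ?M c k)) e = card {x \<in> edge_copies ?M. c x = k \<and> e = fst x}"
      by (simp add: color_class_def count_image_mset' finite_edge_copies conj_assoc)
    also have "{x \<in> edge_copies ?M. c x = k \<and> e = fst x} =
        (if e \<in> ?E then Pair e ` {i \<in> {..<2}. c (e, i) = k} else {})"
      by (auto simp: copies)
    also have "card \<dots> = (if e \<in> ?E then card {i \<in> {..<2}. c (e, i) = k} else 0)"
      by (simp add: card_image inj_on_def)
    also have "\<dots> = (if e \<in> ?E then wt k e else 0)"
    proof (cases "e \<in> ?E")
      case True
      have "{i \<in> {..<2}. c (e, i) = 0} = {..<wt 0 e}"
        "{i \<in> {..<2}. c (e, i) = 1} = {wt 0 e..<wt 0 e + wt 1 e}"
        "{i \<in> {..<2}. c (e, i) = 2} = {wt 0 e + wt 1 e..<2}"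
        using total[OF True] by (auto simp: c_def)
      moreover have "k = 0 \<or> k = 1 \<or> k = 2" using k by linarith
      ultimately have "card {i \<in> {..<2}. c (e, i) = k} = wt k e"
        using total[OF True] by (elim disjE) (simp_all only: card_lessThan card_atLeastLessThan)
      then show ?thesis using True by simp
    qed simp
    finally show ?thesis .
  qed
  have used: "colors_used ?M c \<subseteq> {..<3}" by (auto simp: colors_used_def c_def)
  have "locally_irregular_coloring ?M c"
    unfolding locally_irregular_coloring_def locally_irregular_def
  proof (intro ballI impI)
    fix k u v
    assume "k \<in> colors_used ?M c" and uv: "{u, v} \<in># medges (color_class ?M c k)"
    then have k: "k < 3" using used by auto
    have deg: "mdegree (color_class ?M c k) x = wdeg ?E (wt k) x" for x
    proof -
      have "mdegree (color_class ?M c k) x = (\<Sum>e\<in>{e \<in> ?E. x \<in> e}. count (medges (color_class ?M c k)) e)"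
        unfolding mdegree_def using fin
        by (intro sum.mono_neutral_left)
          (auto simp: class_count[OF k] not_in_iff simp flip: count_greater_zero_iff split: if_splits)
      also have "\<dots> = wdeg ?E (wt k) x"
        unfolding wdeg_def by (rule sum.cong) (auto simp: class_count[OF k])
      finally show ?thesis .
    qed
    have "{u, v} \<in> ?E" "wt k {u, v} > 0"
      using uv class_count[OF k, of "{u, v}"] by (auto simp flip: count_greater_zero_iff split: if_splits)
    then show "mdegree (color_class ?M c k) u \<noteq> mdegree (color_class ?M c k) v"
      unfolding deg using irr[OF k] by blast
  qed
  moreover have "card (colors_used ?M c) \<le> 3" using card_mono[OF _ used] by simp
  ultimately have "lir ?M \<le> enat 3" using lir_le_iff by blast
  then show ?thesis by (simp add: numeral_eq_enat)
qed

lemma lir_of_two_weighting: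
  fixes G :: "'a graph"
  assumes "finite (edges G)" "two_weighting (edges G) w"
  shows "lir (two_multigraph G) \<le> 3"
proof (rule lir_two_multigraph_le_3[where
      wt = "\<lambda>k. if k = 0 then w else if k = 1 then (\<lambda>e. 2 - w e) else (\<lambda>e. 0)"])
  show "finite (edges G)" by fact
qed (use assms(2) in \<open>auto simp: two_weighting_def split: if_splits\<close>)

text \<open>The third colour takes both copies of every edge at \<open>z\<close>. In it the centre
  has degree at least 4 and its neighbours have degree 2. The other two colours live on the
  remaining edges and are separated by \<open>w\<close>.\<close>

lemma lir_of_star:
  fixes G :: "'a graph"
  assumes fin: "finite (edges G)" and two: "\<And>e. e \<in> edges G \<Longrightarrow> card e = 2"
    and z: "edeg (edges G) z \<ge> 2" and w: "two_weighting {e \<in> edges G. z \<notin> e} w"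
  shows "lir (two_multigraph G) \<le> 3"
proof -
  let ?E = "edges G" and ?E' = "{e \<in> edges G. z \<notin> e}"
  define wt :: "nat \<Rightarrow> 'a set \<Rightarrow> nat" where
    "wt k e = (if z \<in> e then (if k = 2 then 2 else 0)
      else if k = 0 then w e else if k = 1 then 2 - w e else 0)" for k e
  have w2: "w e \<le> 2" for e using w by (simp add: two_weighting_def)
  have restrict: "wdeg ?E (wt k) v = wdeg ?E' (wt k) v" if "k \<noteq> 2" for k v
    unfolding wdeg_def using fin that by (intro sum.mono_neutral_right) (auto simp: wt_def)
  have wd0: "wdeg ?E (wt 0) v = wdeg ?E' w v" for v
    by (subst restrict, simp, unfold wdeg_def, rule sum.cong) (auto simp: wt_def)
  have wd1: "wdeg ?E (wt 1) v = wdeg ?E' (\<lambda>e. 2 - w e) v" for v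
    by (subst restrict, simp, unfold wdeg_def, rule sum.cong) (auto simp: wt_def)
  have wd2z: "wdeg ?E (wt 2) z = 2 * edeg ?E z"
    by (simp add: wdeg_def edeg_def wt_def)
  have wd2x: "wdeg ?E (wt 2) x = 2" if e: "{z, x} \<in> ?E" for x
  proof -
    have ne: "z \<noteq> x" using two[OF e] by auto
    have "{e \<in> ?E. x \<in> e \<and> z \<in> e} = {{z, x}}"
    proof -
      have "e = {z, x}" if "e \<in> ?E" "x \<in> e" "z \<in> e" for e
        using pair_containing[OF two[OF that(1)] that(3)] that(2) ne by auto
      then show ?thesis using e by blast
    qed
    moreover have "wdeg ?E (wt 2) x = (\<Sum>e\<in>{e \<in> ?E. x \<in> e \<and> z \<in> e}. 2)"
      unfolding wdeg_def using fin by (intro sum.mono_neutral_cong_right) (auto simp: wt_def)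
    ultimately show ?thesis by simp
  qed
  show ?thesis
  proof (rule lir_two_multigraph_le_3[of G wt, OF fin])
    show "wt 0 e + wt 1 e + wt 2 e = 2" for e using w2[of e] by (simp add: wt_def)
  next
    fix k u v
    assume k: "k < (3::nat)" and e: "{u, v} \<in> ?E" and pos: "wt k {u, v} > 0"
    have "k = 0 \<or> k = 1 \<or> k = 2" using k by linarith
    then consider "z \<in> {u, v}" "k = 2" | "k = 0" "{u, v} \<in> ?E'" "w {u, v} > 0"
      | "k = 1" "{u, v} \<in> ?E'" "w {u, v} < 2"
      using pos e unfolding wt_def by (auto split: if_splits)
    then show "wdeg ?E (wt k) u \<noteq> wdeg ?E (wt k) v"
    proof cases
      case 1
      then consider "u = z" | "v = z" by blast
      then show ?thesis
      proof cases
        case 1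
        then show ?thesis using \<open>k = 2\<close> e z wd2z wd2x[of v] by simp
      next
        case 2
        then show ?thesis using \<open>k = 2\<close> e z wd2z wd2x[of u] by (simp add: insert_commute)
      qed
    next
      case 2
      then show ?thesis using w unfolding two_weighting_def \<open>k = 0\<close> wd0 by blast
    next
      case 3
      then show ?thesis using w unfolding two_weighting_def \<open>k = 1\<close> wd1 by blast
    qed
  qed
qed

section \<open>From a suitable cut to three colours\<close>

lemma crosses_remove: "r \<notin> e \<Longrightarrow> crosses (B - {r}) e \<longleftrightarrow> crosses B e"
proof -
  assume "r \<notin> e"
  then have "e \<inter> (B - {r}) = e \<inter> B" by blast
  then show ?thesis by (simp add: crosses_def)
qed

text \<open>An odd \<open>B\<close> is made even by taking out \<open>r\<close>, whose deletion
  keeps the crossing edges connected. If \<open>r\<close> has degree at least 2, its star gets the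
  third colour. If \<open>r\<close> is a leaf, the treatment depends on whether its neighbour
  \<open>u\<close> lies on an inside edge.\<close>

lemma lir_of_cut:
  fixes G :: "'a graph"
  defines "E \<equiv> edges G" and "V \<equiv> verts G"
  assumes V: "finite V" and E: "\<And>e. e \<in> E \<Longrightarrow> card e = 2 \<and> e \<subseteq> V" "E \<noteq> {}"
    and deg: "\<And>v. edeg E v \<le> 3"
    and not_K2: "\<And>u v. {u, v} \<in> E \<Longrightarrow> V \<noteq> {u, v}"
    and B: "B \<subseteq> V" "connected_via {e \<in> E. crosses B e} V"
    and matching: "\<And>e e'. \<lbrakk>e \<in> E; e' \<in> E; \<not> crosses B e; \<not> crosses B e'; e \<inter> e' \<noteq> {}\<rbrakk> \<Longrightarrow> e = e'"
    and r: "r \<in> V" "connected_via {e \<in> E. crosses B e} (V - {r})" "even (card B) \<or> r \<in> B"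
  shows "lir (two_multigraph G) \<le> 3"
proof -
  let ?F = "{e \<in> E. crosses B e}"
  have "E \<subseteq> Pow V" using E by blast
  then have fin: "finite E" using V by (simp add: finite_subset)
  have two: "card e = 2" if "e \<in> E" for e using E that by blast
  have inV: "u \<in> V" "v \<in> V" "u \<noteq> v" if "{u, v} \<in> E" for u v using E(1)[OF that] by auto
  show ?thesis
  proof (cases "even (card B)")
    case True
    have "\<exists>w. two_weighting E w"
      by (rule two_weighting_exists[OF fin two deg matching V B(1) True B(2)]) (use inV in auto)
    then show ?thesis using lir_of_two_weighting fin unfolding E_def by blast
  next
    case False
    then have rB: "r \<in> B" using r(3) by blast
    have evB: "even (card (B - {r}))" using False rB finite_subset[OF B(1) V] by simp
    have edeg': "edeg {e \<in> E. z \<notin> e} v \<le> 3" for z v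
      using edeg_mono[OF fin, of "{e \<in> E. z \<notin> e}" v] deg[of v] by auto
    show ?thesis
    proof (cases "edeg E r \<ge> 2")
      case True
      let ?E' = "{e \<in> E. r \<notin> e}"
      have c: "crosses (B - {r}) e \<longleftrightarrow> crosses B e" if "e \<in> ?E'" for e
        by (rule crosses_remove) (use that in auto)
      have "\<exists>w. two_weighting ?E' w"
      proof (rule two_weighting_exists[of ?E' "B - {r}" "V - {r}"])
        show "connected_via {e \<in> ?E'. crosses (B - {r}) e} (V - {r})"
          using r(2) by (rule connected_via_mono) (auto simp: crosses_remove)
        show "e = e'" if "e \<in> ?E'" "e' \<in> ?E'" "\<not> crosses (B - {r}) e" "\<not> crosses (B - {r}) e'" "e \<inter> e' \<noteq> {}"
          for e e' using matching[of e e'] that c by blast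
      qed (use fin two edeg' V B(1) evB inV in auto)
      then show ?thesis using lir_of_star[of G r] fin two True unfolding E_def by blast
    next
      case leaf: False
      \<comment> \<open>An edge exists, so there is a vertex besides \<open>r\<close>, and
        connectedness of the crossing edges gives \<open>r\<close> a neighbour \<open>u\<close> on
        the other side.\<close>
      obtain e0 where e0: "e0 \<in> E" using E(2) by blast
      then obtain p q where "e0 = {p, q}" "p \<noteq> q" using two[OF e0] by (auto simp: card_2_iff)
      then obtain y where y: "y \<in> V" "y \<noteq> r" using inV[of p q] e0 by metis
      then have "(r, y) \<in> reach ?F V" using B(2) r(1) by (simp add: connected_via_def)
      then obtain a u where "a \<in> {r}" "u \<in> V - {r}" "{a, u} \<in> ?F"
        by (rule reach_leaves[of _ _ _ _ "{r}"]) (use y in auto)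
      then have ru: "{r, u} \<in> E" "crosses B {r, u}" and u: "u \<in> V" "u \<noteq> r" by auto
      have only: "e = {r, u}" if "e \<in> E" "r \<in> e" for e
      proof -
        have "card {e \<in> E. r \<in> e} \<le> Suc 0" using leaf by (simp add: edeg_def)
        then show ?thesis using fin ru that by (subst (asm) card_le_Suc0_iff_eq) auto
      qed
      have uB: "u \<notin> B" using crosses_pair[of r u B] ru(2) u(2) rB by auto
      show ?thesis
      proof (cases "\<exists>v. {u, v} \<in> E \<and> \<not> crosses B {u, v}")
        case True
        then obtain v where v: "{u, v} \<in> E" "\<not> crosses B {u, v}" by blast
        have vr: "v \<noteq> r" using v(2) ru(2) by (auto simp: insert_commute)
        have "card {r, v} \<le> edeg E u"
          by (rule card_le_edeg[OF fin]) (use ru v in \<open>auto simp: insert_commute\<close>)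
        then have deg_u: "edeg E u \<ge> 2" using vr by simp
        txt \<open>The third colour takes the star at \<open>u\<close>. As \<open>u\<close> has an inside edge, it has at most one
          crossing edge besides \<open>{r, u}\<close>, so removing \<open>r\<close> and \<open>u\<close> keeps the crossing edges connected.\<close>
        let ?E' = "{e \<in> E. u \<notin> e}"
        have rE': "r \<notin> e" if "e \<in> ?E'" for e using only[of e] that by auto
        have c: "crosses (B - {r}) e \<longleftrightarrow> crosses B e" if "e \<in> ?E'" for e
          using rE'[OF that] by (rule crosses_remove)
        have con: "connected_via ?F (V - {r} - {u})"
        proof (rule connected_via_remove_pendant[OF r(2)], rule ccontr)
          fix x y
          assume xy: "x \<in> V - {r}" "y \<in> V - {r}" "{u, x} \<in> ?F" "{u, y} \<in> ?F" "x \<noteq> y"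
          have "card {r, v, x, y} \<le> edeg E u"
            by (rule card_le_edeg[OF fin]) (use ru v xy in \<open>auto simp: insert_commute\<close>)
          moreover have "v \<noteq> x" "v \<noteq> y" using v(2) xy by auto
          then have "card {r, v, x, y} = 4" using vr xy by auto
          ultimately show False using deg[of u] by simp
        qed
        have "\<exists>w. two_weighting ?E' w"
        proof (rule two_weighting_exists[of ?E' "B - {r}" "V - {r} - {u}"])
          show "connected_via {e \<in> ?E'. crosses (B - {r}) e} (V - {r} - {u})"
            using con by (rule connected_via_mono) (auto simp: crosses_remove)
          show "e = e'" if "e \<in> ?E'" "e' \<in> ?E'" "\<not> crosses (B - {r}) e" "\<not> crosses (B - {r}) e'" "e \<inter> e' \<noteq> {}"
            for e e' using matching[of e e'] that c by blast
          show "x \<in> V - {r} - {u} \<and> y \<in> V - {r} - {u}" if "{x, y} \<in> ?E'" for x y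
            using that rE'[OF that] inV[of x y] by auto
        qed (use fin two edeg' V B(1) evB uB in auto)
        then show ?thesis using lir_of_star[of G u] fin two deg_u unfolding E_def by blast
      next
        case no_inside: False
        txt \<open>Moving \<open>r\<close> to the other side makes \<open>{r, u}\<close> an inside edge with ends of different degrees,
          which is harmless, and makes the size of \<open>B\<close> even without a third colour.\<close>
        have c: "crosses (B - {r}) e \<longleftrightarrow> crosses B e \<and> e \<noteq> {r, u}" if "e \<in> E" for e
        proof (cases "r \<in> e")
          case True
          then show ?thesis using only[OF that] crosses_pair[of r u "B - {r}"] u(2) uB by auto
        next
          case False
          then show ?thesis using crosses_remove[OF False] by auto
        qed
        \<comment> \<open>As \<open>V\<close> is not \<open>{r, u}\<close>, there is a third vertex.
          A crossing path to it leaves \<open>{r, u}\<close> at \<open>u\<close>, since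
          \<open>r\<close> is a leaf; so \<open>u\<close> has degree at least 2, unlike
          \<open>r\<close>.\<close>
        obtain x where x: "x \<in> V" "x \<noteq> r" "x \<noteq> u" using not_K2[OF ru(1)] r(1) u(1) by blast
        then have "(u, x) \<in> reach ?F V" using B(2) u(1) by (simp add: connected_via_def)
        then obtain a b where ab: "a \<in> {r, u}" "b \<in> V - {r, u}" "{a, b} \<in> ?F"
          by (rule reach_leaves[of _ _ _ _ "{r, u}"]) (use x in auto)
        then have "a = u" using only[of "{a, b}"] by (auto simp: doubleton_eq_iff)
        then have "card {r, b} \<le> edeg E u"
          using ab by (intro card_le_edeg[OF fin]) (use ru in \<open>auto simp: insert_commute\<close>)
        then have deg_u: "edeg E u \<noteq> edeg E r" using leaf ab(2) by auto
        have "\<exists>w. two_weighting E w"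
        proof (rule two_weighting_exists[of E "B - {r}" "V - {r}"])
          show "connected_via {e \<in> E. crosses (B - {r}) e} (V - {r})"
            using r(2) by (rule connected_via_mono) (auto simp: crosses_remove)
          show "e = e'" if e: "e \<in> E" "e' \<in> E" "\<not> crosses (B - {r}) e" "\<not> crosses (B - {r}) e'" "e \<inter> e' \<noteq> {}" for e e'
          proof -
            \<comment> \<open>The move makes only \<open>{r, u}\<close> a new inside edge. It meets
              no other inside edge, because \<open>u\<close> had none and \<open>r\<close> lies on
              no other edge.\<close>
            have at_u: "g = {r, u}" if "g \<in> E" "g \<inter> {r, u} \<noteq> {}" "\<not> crosses (B - {r}) g" for g
            proof (rule ccontr)
              assume "g \<noteq> {r, u}"
              then have "u \<in> g" "\<not> crosses B g" using only[OF that(1)] that c by auto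
              then show False using no_inside pair_containing[OF two[OF that(1)], of u] that(1) by blast
            qed
            show ?thesis
            proof (cases "e = {r, u} \<or> e' = {r, u}")
              case True
              then show ?thesis using at_u[OF e(1)] at_u[OF e(2)] e by blast
            next
              case False
              then show ?thesis using matching e c by blast
            qed
          qed
          show "x \<in> V - {r} \<and> y \<in> V - {r}" if e: "{x, y} \<in> E" "edeg E x = edeg E y" for x y
          proof -
            have "r \<notin> {x, y}"
            proof
              assume "r \<in> {x, y}"
              then have "{x, y} = {r, u}" using only e by blast
              then show False using deg_u e(2) by (auto simp: doubleton_eq_iff)
            qed
            then show ?thesis using inV[OF e(1)] by auto
          qed
        qed (use fin two deg V B(1) evB in auto)
        then show ?thesis using lir_of_two_weighting fin unfolding E_def by blast
      qed
    qed
  qed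
qed

lemma complete_graph_2_iso:
  assumes "verts G = {u, v}" "{u, v} \<in> edges G" "\<And>e. e \<in> edges G \<Longrightarrow> card e = 2"
  shows "graph_isomorphic G (complete_graph 2)"
proof -
  have "u \<noteq> v" using assms(2,3) by fastforce
  let ?f = "\<lambda>x. if x = u then 0 else (1::nat)"
  have "bij_betw ?f {u, v} {..<2}"
    using \<open>u \<noteq> v\<close> by (auto simp: bij_betw_def inj_on_def)
  moreover have "{x, x} \<notin> edges G" for x using assms(3)[of "{x, x}"] by auto
  ultimately show ?thesis
    unfolding graph_isomorphic_def assms(1)
    using \<open>u \<noteq> v\<close> assms(2)
    by (intro exI[of _ ?f]) (auto simp: complete_graph_def insert_commute)
qed

theorem theorem13:
  fixes G :: "'a graph"
  assumes "simple_graph G"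
    and "connected_graph G"
    and "subcubic G"
    and "\<not> graph_isomorphic G (complete_graph 2)"
  shows "lir (two_multigraph G) \<le> 3"
proof (cases "edges G = {}")
  case True
  then have "two_weighting (edges G) (\<lambda>_. 0)" by (simp add: two_weighting_def)
  then show ?thesis using lir_of_two_weighting[of G] True by simp
next
  case nonempty: False
  let ?E = "edges G" and ?V = "verts G"
  have V: "finite ?V" and E: "\<And>e. e \<in> ?E \<Longrightarrow> card e = 2 \<and> e \<subseteq> ?V"
    using assms(1) by (auto simp: simple_graph_def)
  have deg: "edeg ?E v \<le> 3" for v
  proof (cases "v \<in> ?V")
    case True
    then have "edeg ?E v \<le> max_degree G"
      unfolding max_degree_def degree_def edeg_def using V by (intro Max_ge) auto
    then show ?thesis using assms(3) by (simp add: subcubic_def)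
  next
    case False
    then have "{e \<in> ?E. v \<in> e} = {}" using E by blast
    then show ?thesis unfolding edeg_def by (simp only: card.empty)
  qed
  have "{(x, y). {x, y} \<in> ?E} = {(x, y). {x, y} \<in> ?E \<and> x \<in> ?V \<and> y \<in> ?V}" using E by blast
  then have con: "connected_via ?E ?V" using assms(2) by (simp add: connected_graph_def connected_via_def reach_def)
  have not_K2: "?V \<noteq> {u, v}" if "{u, v} \<in> ?E" for u v
    using complete_graph_2_iso[of G u v] that E assms(4) by blast
  obtain B where B: "B \<subseteq> ?V" "connected_via {e \<in> ?E. crosses B e} ?V"
    "\<And>e e'. \<lbrakk>e \<in> ?E; e' \<in> ?E; \<not> crosses B e; \<not> crosses B e'; e \<inter> e' \<noteq> {}\<rbrakk> \<Longrightarrow> e = e'"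
    using connected_cut_exists[OF V E deg con] by blast
  obtain e0 where e0: "e0 \<in> ?E" using nonempty by blast
  obtain p q where pq: "e0 = {p, q}" "p \<noteq> q" using E[OF e0] by (auto simp: card_2_iff)
  then have "p \<in> ?V" "q \<in> ?V" using E[OF e0] by auto
  then obtain r where r: "r \<in> ?V" "connected_via {e \<in> ?E. crosses B e} (?V - {r})"
    using noncut_vertex[OF V B(2)] pq by blast
  show ?thesis
  proof (cases "even (card B) \<or> r \<in> B")
    case True
    show ?thesis by (rule lir_of_cut[OF V E nonempty deg not_K2 B r True])
  next
    case False
    \<comment> \<open>A set and its complement define the same cut. Here \<open>B\<close> is odd and
      misses \<open>r\<close>, so the complement contains \<open>r\<close> and can take the role of
      \<open>B\<close>.\<close>
    have c: "crosses (?V - B) e \<longleftrightarrow> crosses B e" if e: "e \<in> ?E" for e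
    proof -
      obtain x y where "e = {x, y}" "x \<noteq> y" using E[OF e] by (auto simp: card_2_iff)
      then show ?thesis using E[OF e] by (auto simp: crosses_pair)
    qed
    then have F: "{e \<in> ?E. crosses (?V - B) e} = {e \<in> ?E. crosses B e}" by blast
    show ?thesis
    proof (rule lir_of_cut[OF V E nonempty deg not_K2, of "?V - B" r])
      show "connected_via {e \<in> ?E. crosses (?V - B) e} ?V" "connected_via {e \<in> ?E. crosses (?V - B) e} (?V - {r})"
        unfolding F by fact+
      show "e = e'" if "e \<in> ?E" "e' \<in> ?E" "\<not> crosses (?V - B) e" "\<not> crosses (?V - B) e'" "e \<inter> e' \<noteq> {}" for e e'
        using B(3)[of e e'] that c by blast
    qed (use r False in auto)
  qed
qed

end
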